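(* Let $X$ be a finite $d$-dimensional simplicial complex ($d\ge 1$) in which only the $d$-dimensional simplices are weighted (positive weights collected in the diagonal matrix $W_d$; all other simplices have weight $1$). Let $B_p$ be the matrix of the boundary operator $\partial_p$ in the standard bases of oriented simplices. If the Hodge Laplacian matrix $L_{d-1}=B_dW_dB_d^\top+B_{d-1}^\top B_{d-1}$ is invertible, then the resistance matrices $R_d=B_d^\top(B_dW_dB_d^\top)^{+}B_d$ and $R'_d=B_d^\top L_{d-1}^{-1}B_d$ agree, i.e. $$B_d^\top\left(B_dW_dB_d^\top\right)^{+}B_d = B_d^\top\left(B_dW_dB_d^\top+B_{d-1}^\top B_{d-1}\right)^{-1}B_d .$$
   Context: $^{+}$ denotes the Moore–Penrose inverse of a real matrix. Simplices are oriented by a fixed ordering of the vertices; $B_p$ is the $n_{p-1}\times n_p$ signed incidence matrix, $n_p$ being the number of $p$-simplices. For $d=1$, $B_0$ is the matrix of the augmentation map $C_0(X)\to\mathbb{R}$ (all-ones row), as in reduced homology. *)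

theory Defs
  imports "Jordan_Normal_Form.Gauss_Jordan_Elimination"
begin

definition simplicial_complex :: "'a set set \<Rightarrow> bool" where
  "simplicial_complex X \<longleftrightarrow>
     (\<forall>\<sigma>\<in>X. finite \<sigma> \<and> \<sigma> \<noteq> {}) \<and>
     (\<forall>\<sigma>\<in>X. \<forall>\<tau>. \<tau> \<noteq> {} \<and> \<tau> \<subseteq> \<sigma> \<longrightarrow> \<tau> \<in> X)"

definition simplices :: "'a set set \<Rightarrow> nat \<Rightarrow> 'a set set" where
  "simplices X p = {\<sigma> \<in> X. card \<sigma> = Suc p}"

definition has_dimension :: "'a set set \<Rightarrow> nat \<Rightarrow> bool" where
  "has_dimension X d \<longleftrightarrow> simplices X d \<noteq> {} \<and> (\<forall>\<sigma>\<in>X. card \<sigma> \<le> Suc d)"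

(* e p lists the p-simplices of X without repetition; it fixes the order of the
   standard basis of the p-chains, so that n_p = length (e p). *)
definition simplex_enumeration :: "'a set set \<Rightarrow> (nat \<Rightarrow> 'a set list) \<Rightarrow> bool" where
  "simplex_enumeration X e \<longleftrightarrow> (\<forall>p. distinct (e p) \<and> set (e p) = simplices X p)"

(* The coefficient of \<tau> in
     \<partial>[v_0,...,v_p] = (\<Sum>i\<le>p. (-1)^i [v_0,...,v_(i-1),v_(i+1),...,v_p])
   where v_0 < ... < v_p are the vertices of \<sigma>; the index of a vertex v is the
   number of vertices of \<sigma> below it. *)
definition boundary_coeff :: "'a::linorder set \<Rightarrow> 'a set \<Rightarrow> real" where
  "boundary_coeff \<sigma> \<tau> =
     (\<Sum>v\<in>\<sigma>. if \<tau> = \<sigma> - {v} then (-1) ^ card {u\<in>\<sigma>. u < v} else 0)"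

(* boundary_matrix e 0 is the 1 x n_0 matrix of the augmentation map. *)
fun boundary_matrix :: "(nat \<Rightarrow> 'a::linorder set list) \<Rightarrow> nat \<Rightarrow> real mat" where
  "boundary_matrix e 0 = mat 1 (length (e 0)) (\<lambda>_. 1)"
| "boundary_matrix e (Suc p) =
     mat (length (e p)) (length (e (Suc p)))
       (\<lambda>(i, j). boundary_coeff (e (Suc p) ! j) (e p ! i))"

definition weight_matrix :: "(nat \<Rightarrow> 'a set list) \<Rightarrow> ('a set \<Rightarrow> real) \<Rightarrow> nat \<Rightarrow> real mat" where
  "weight_matrix e w p = mat_diag (length (e p)) (\<lambda>i. w (e p ! i))"

definition is_mp_inverse :: "real mat \<Rightarrow> real mat \<Rightarrow> bool" where
  "is_mp_inverse A Y \<longleftrightarrow>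
     Y \<in> carrier_mat (dim_col A) (dim_row A) \<and>
     A * Y * A = A \<and> Y * A * Y = Y \<and>
     transpose_mat (A * Y) = A * Y \<and> transpose_mat (Y * A) = Y * A"

definition mp_inverse :: "real mat \<Rightarrow> real mat" where
  "mp_inverse A = (THE Y. is_mp_inverse A Y)"

lemma is_mp_inverse_unique:
  assumes Y: "is_mp_inverse A Y" and Z: "is_mp_inverse A Z"
  shows "Y = Z"
proof -
  define n m where "n = dim_row A" and "m = dim_col A"
  have [simp]: "A \<in> carrier_mat n m" "Y \<in> carrier_mat m n" "Z \<in> carrier_mat m n"
    using Y Z by (auto simp: is_mp_inverse_def n_def m_def)
  note Yp = Y[unfolded is_mp_inverse_def] and Zp = Z[unfolded is_mp_inverse_def]
  have AY[simp]: "A * Y \<in> carrier_mat n n" and AZ[simp]: "A * Z \<in> carrier_mat n n"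
    and YA[simp]: "Y * A \<in> carrier_mat m m" and ZA[simp]: "Z * A \<in> carrier_mat m m"
    by (auto intro: mult_carrier_mat[of _ _ m] mult_carrier_mat[of _ _ n])
  have "(A * Z) * (A * Y) = (A * Z * A) * Y"
    by (rule assoc_mult_mat[symmetric, of _ n n _ m _ n]) auto
  then have 1: "(A * Z) * (A * Y) = A * Y" using Zp by simp
  have "(A * Y) * (A * Z) = (A * Y * A) * Z"
    by (rule assoc_mult_mat[symmetric, of _ n n _ m _ n]) auto
  then have 2: "(A * Y) * (A * Z) = A * Z" using Yp by simp
  have "A * Y = transpose_mat ((A * Z) * (A * Y))" using 1 Yp by simp
  also have "\<dots> = transpose_mat (A * Y) * transpose_mat (A * Z)"
    by (rule transpose_mult[of _ n n _ n]) auto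
  also have "\<dots> = A * Z" using 2 Yp Zp by simp
  finally have eqL: "A * Y = A * Z" .
  have "(Y * A) * (Z * A) = Y * (A * (Z * A))"
    by (rule assoc_mult_mat[of _ m n _ m _ m]) auto
  also have "A * (Z * A) = A * Z * A"
    by (rule assoc_mult_mat[symmetric, of _ n m _ n _ m]) auto
  finally have 3: "(Y * A) * (Z * A) = Y * A" using Zp by simp
  have "(Z * A) * (Y * A) = Z * (A * (Y * A))"
    by (rule assoc_mult_mat[of _ m n _ m _ m]) auto
  also have "A * (Y * A) = A * Y * A"
    by (rule assoc_mult_mat[symmetric, of _ n m _ n _ m]) auto
  finally have 4: "(Z * A) * (Y * A) = Z * A" using Yp by simp
  have "Y * A = transpose_mat ((Y * A) * (Z * A))" using 3 Yp by simp
  also have "\<dots> = transpose_mat (Z * A) * transpose_mat (Y * A)"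
    by (rule transpose_mult[of _ m m _ m]) auto
  also have "\<dots> = Z * A" using 4 Yp Zp by simp
  finally have eqR: "Y * A = Z * A" .
  have "Y = Y * A * Y" using Yp by simp
  also have "\<dots> = Z * A * Y" using eqR by simp
  also have "\<dots> = Z * (A * Y)" by (rule assoc_mult_mat[of _ m n _ m _ n]) auto
  also have "\<dots> = Z * (A * Z)" using eqL by simp
  also have "\<dots> = Z * A * Z" by (rule assoc_mult_mat[symmetric, of _ m n _ m _ n]) auto
  also have "\<dots> = Z" using Zp by simp
  finally show ?thesis .
qed

lemma mp_inverse_eqI: "is_mp_inverse A Y \<Longrightarrow> mp_inverse A = Y"
  unfolding mp_inverse_def using is_mp_inverse_unique by blast

definition up_laplacian ::
    "(nat \<Rightarrow> 'a::linorder set list) \<Rightarrow> ('a set \<Rightarrow> real) \<Rightarrow> nat \<Rightarrow> real mat" where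
  "up_laplacian e w d =
     boundary_matrix e d * weight_matrix e w d * transpose_mat (boundary_matrix e d)"

(* L_(d-1), for d \<ge> 1, when all simplices of dimension below d have weight 1. *)
definition hodge_laplacian ::
    "(nat \<Rightarrow> 'a::linorder set list) \<Rightarrow> ('a set \<Rightarrow> real) \<Rightarrow> nat \<Rightarrow> real mat" where
  "hodge_laplacian e w d =
     up_laplacian e w d + transpose_mat (boundary_matrix e (d - 1)) * boundary_matrix e (d - 1)"

definition resistance_matrix ::
    "(nat \<Rightarrow> 'a::linorder set list) \<Rightarrow> ('a set \<Rightarrow> real) \<Rightarrow> nat \<Rightarrow> real mat" where
  "resistance_matrix e w d =
     transpose_mat (boundary_matrix e d) * mp_inverse (up_laplacian e w d) * boundary_matrix e d"

definition resistance_matrix' ::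
    "(nat \<Rightarrow> 'a::linorder set list) \<Rightarrow> ('a set \<Rightarrow> real) \<Rightarrow> nat \<Rightarrow> real mat" where
  "resistance_matrix' e w d =
     transpose_mat (boundary_matrix e d) * the (mat_inverse (hodge_laplacian e w d))
       * boundary_matrix e d"

end

theory Submission
  imports Defs
begin

text \<open>
  Write \<open>B\<close>, \<open>C\<close> for the boundary matrices in degrees \<open>d\<close> and \<open>d - 1\<close>, put \<open>U = B W B\<^sup>T\<close> and
  \<open>L = U + C\<^sup>T C\<close>, and let \<open>M\<close> be the inverse of \<open>L\<close>. The identity \<open>C B = 0\<close> makes the two
  summands of \<open>L\<close> annihilate each other, so that \<open>L U = U U = U L\<close>. Hence \<open>M\<close> commutes with \<open>U\<close>, and
  \<open>U M\<close> is a symmetric idempotent, the orthogonal projection onto the range of \<open>U\<close>. It follows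
  that \<open>M U M\<close> is the Moore--Penrose inverse of \<open>U\<close>
  (\<open>is_mp_inverse_sandwich\<close>). Moreover \<open>L B = U B\<close>, that is, \<open>U M B = B\<close>, and therefore
  \<open>B\<^sup>T (M U M) B = B\<^sup>T M B\<close>, which is the assertion.

  The topological input is \<open>C B = 0\<close>, the usual cancellation in pairs of the faces obtained by
  deleting two vertices in either order. The augmentation map needs no separate argument: on
  vertices, the boundary coefficient at the empty face is \<open>1\<close>, so the all-ones row is the boundary
  matrix from vertices to the empty simplex.
\<close>

section \<open>The boundary of a boundary\<close>

definition vertex_sign :: "'a::linorder set \<Rightarrow> 'a \<Rightarrow> real" where
  "vertex_sign \<sigma> v = (-1) ^ card {u\<in>\<sigma>. u < v}"

lemma boundary_coeff_alt:
  "boundary_coeff \<sigma> \<tau> = (\<Sum>v\<in>\<sigma>. if \<tau> = \<sigma> - {v} then vertex_sign \<sigma> v else 0)"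
  unfolding boundary_coeff_def vertex_sign_def ..

text \<open>Deleting \<open>v\<close> lowers the position of exactly the later vertices by one.\<close>

lemma vertex_sign_Diff:
  assumes "finite \<sigma>" and "v \<in> \<sigma>"
  shows "vertex_sign (\<sigma> - {v}) u = (if v < u then - vertex_sign \<sigma> u else vertex_sign \<sigma> u)"
proof (cases "v < u")
  case True
  have "{x\<in>\<sigma>. x < u} = insert v {x\<in>\<sigma> - {v}. x < u}"
    using True assms by auto
  then have "card {x\<in>\<sigma>. x < u} = Suc (card {x\<in>\<sigma> - {v}. x < u})"
    using assms by simp
  then show ?thesis
    using True by (simp add: vertex_sign_def)
next
  case False
  then have "{x\<in>\<sigma> - {v}. x < u} = {x\<in>\<sigma>. x < u}" by auto
  then show ?thesis using False by (simp add: vertex_sign_def)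
qed

text \<open>
  Every face of codimension two arises by deleting two vertices, in either order. By
  \<open>vertex_sign_Diff\<close> the two orders contribute opposite signs, so swapping them turns the sum into
  its negative.
\<close>

lemma boundary_coeff_boundary_coeff:
  fixes \<sigma> \<rho> :: "'a::linorder set"
  assumes fin: "finite \<sigma>" and finT: "finite T" and faces: "\<And>v. v \<in> \<sigma> \<Longrightarrow> \<sigma> - {v} \<in> T"
  shows "(\<Sum>\<tau>\<in>T. boundary_coeff \<tau> \<rho> * boundary_coeff \<sigma> \<tau>) = 0"
proof -
  define f where "f v u =
    (if u \<noteq> v \<and> \<rho> = \<sigma> - {v} - {u} then vertex_sign (\<sigma> - {v}) u * vertex_sign \<sigma> v else 0)" for v u
  have "(\<Sum>\<tau>\<in>T. boundary_coeff \<tau> \<rho> * boundary_coeff \<sigma> \<tau>)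
      = (\<Sum>\<tau>\<in>T. \<Sum>v\<in>\<sigma>. if \<tau> = \<sigma> - {v} then boundary_coeff \<tau> \<rho> * vertex_sign \<sigma> v else 0)"
    by (simp add: boundary_coeff_alt[of \<sigma>] sum_distrib_left if_distrib cong: if_cong)
  also have "\<dots> = (\<Sum>v\<in>\<sigma>. \<Sum>\<tau>\<in>T. if \<tau> = \<sigma> - {v} then boundary_coeff \<tau> \<rho> * vertex_sign \<sigma> v else 0)"
    by (rule sum.swap)
  also have "\<dots> = (\<Sum>v\<in>\<sigma>. boundary_coeff (\<sigma> - {v}) \<rho> * vertex_sign \<sigma> v)"
    using faces finT by (intro sum.cong) simp_all
  also have "\<dots> = (\<Sum>v\<in>\<sigma>. \<Sum>u\<in>\<sigma>. f v u)"
  proof (rule sum.cong[OF refl])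
    fix v assume "v \<in> \<sigma>"
    have "boundary_coeff (\<sigma> - {v}) \<rho> * vertex_sign \<sigma> v = (\<Sum>u\<in>\<sigma> - {v}. f v u)"
      unfolding boundary_coeff_alt sum_distrib_right f_def by (rule sum.cong) auto
    also have "\<dots> = (\<Sum>u\<in>\<sigma>. f v u)"
      using fin by (intro sum.mono_neutral_left) (auto simp: f_def)
    finally show "boundary_coeff (\<sigma> - {v}) \<rho> * vertex_sign \<sigma> v = (\<Sum>u\<in>\<sigma>. f v u)" .
  qed
  finally have S: "(\<Sum>\<tau>\<in>T. boundary_coeff \<tau> \<rho> * boundary_coeff \<sigma> \<tau>) = (\<Sum>v\<in>\<sigma>. \<Sum>u\<in>\<sigma>. f v u)" .
  have antisym: "f u v = - f v u" if "v \<in> \<sigma>" "u \<in> \<sigma>" for u v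
    using that fin
    by (cases u v rule: linorder_cases)
       (auto simp: f_def vertex_sign_Diff Diff_insert[symmetric] insert_commute mult.commute)
  have "(\<Sum>v\<in>\<sigma>. \<Sum>u\<in>\<sigma>. f v u) = (\<Sum>v\<in>\<sigma>. \<Sum>u\<in>\<sigma>. f u v)"
    by (rule sum.swap)
  also have "\<dots> = (\<Sum>v\<in>\<sigma>. \<Sum>u\<in>\<sigma>. - f v u)"
    by (intro sum.cong refl antisym)
  also have "\<dots> = - (\<Sum>v\<in>\<sigma>. \<Sum>u\<in>\<sigma>. f v u)"
    by (simp add: sum_negf)
  finally show ?thesis using S by simp
qed

lemma boundary_coeff_vertex:
  assumes "card \<tau> = Suc 0"
  shows "boundary_coeff \<tau> {} = 1"
proof -
  obtain v where "\<tau> = {v}" using assms by (auto simp: card_Suc_eq)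
  then show ?thesis by (simp add: boundary_coeff_def cong: conj_cong)
qed

lemma facet_mem_simplices:
  assumes "simplicial_complex X" and "\<sigma> \<in> simplices X (Suc p)" and "v \<in> \<sigma>"
  shows "\<sigma> - {v} \<in> simplices X p"
proof -
  have card: "card (\<sigma> - {v}) = Suc p" and mem: "\<sigma> \<in> X"
    using assms by (auto simp: simplices_def)
  have "\<sigma> - {v} \<noteq> {}"
    using card by (metis card.empty nat.distinct(1))
  then have "\<sigma> - {v} \<noteq> {} \<and> \<sigma> - {v} \<subseteq> \<sigma>" by (intro conjI Diff_subset)
  then have "\<sigma> - {v} \<in> X"
    by (rule assms(1)[unfolded simplicial_complex_def, THEN conjunct2, rule_format, OF mem])
  then show ?thesis using card unfolding simplices_def by (intro CollectI conjI)
qed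

lemma dim_col_boundary_matrix [simp]: "dim_col (boundary_matrix e p) = length (e p)"
  by (cases p) simp_all

lemma boundary_matrix_mult_boundary_matrix:
  fixes X :: "'a::linorder set set"
  assumes X: "simplicial_complex X" and e: "simplex_enumeration X e"
  shows "boundary_matrix e p * boundary_matrix e (Suc p)
    = 0\<^sub>m (dim_row (boundary_matrix e p)) (length (e (Suc p)))"
proof (rule eq_matI)
  fix i j
  assume "i < dim_row (0\<^sub>m (dim_row (boundary_matrix e p)) (length (e (Suc p))))"
    and "j < dim_col (0\<^sub>m (dim_row (boundary_matrix e p)) (length (e (Suc p))))"
  then have i: "i < dim_row (boundary_matrix e p)" and j: "j < length (e (Suc p))"
    by simp_all
  define \<sigma> where "\<sigma> = e (Suc p) ! j"
  have e_set: "set (e q) = simplices X q" and e_dist: "distinct (e q)" for q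
    using e by (auto simp: simplex_enumeration_def)
  have \<sigma>: "\<sigma> \<in> simplices X (Suc p)"
    using j e_set[of "Suc p"] unfolding \<sigma>_def by (metis nth_mem)
  have fin: "finite \<sigma>"
    using \<sigma> X by (auto simp: simplicial_complex_def simplices_def)
  \<comment> \<open>The face indexing row \<open>i\<close>; for the augmentation map it is the empty one.\<close>
  obtain \<rho> where row: "\<And>k. k < length (e p) \<Longrightarrow> boundary_matrix e p $$ (i, k) = boundary_coeff (e p ! k) \<rho>"
  proof (cases p)
    case 0
    have "boundary_matrix e p $$ (i, k) = boundary_coeff (e p ! k) {}" if k: "k < length (e p)" for k
    proof -
      have "card (e p ! k) = Suc 0"
        using nth_mem[OF k] e_set[of p] 0 by (simp add: simplices_def)
      then show ?thesis using 0 i k by (simp add: boundary_coeff_vertex)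
    qed
    then show thesis by (rule that)
  next
    case (Suc q)
    show thesis
      by (rule that[of "e q ! i"]) (use Suc i in simp)
  qed
  have "(boundary_matrix e p * boundary_matrix e (Suc p)) $$ (i, j)
      = (\<Sum>k<length (e p). boundary_matrix e p $$ (i, k) * boundary_matrix e (Suc p) $$ (k, j))"
    using i j by (simp add: scalar_prod_def atLeast0LessThan)
  also have "\<dots> = (\<Sum>k<length (e p). boundary_coeff (e p ! k) \<rho> * boundary_coeff \<sigma> (e p ! k))"
    using j by (intro sum.cong) (simp_all add: row \<sigma>_def)
  also have "\<dots> = (\<Sum>\<tau>\<in>set (e p). boundary_coeff \<tau> \<rho> * boundary_coeff \<sigma> \<tau>)"
    by (rule sum.reindex_bij_betw[OF bij_betw_nth[OF e_dist refl refl]])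
  also have "\<dots> = 0"
    using fin facet_mem_simplices[OF X \<sigma>]
    by (intro boundary_coeff_boundary_coeff) (simp_all flip: e_set)
  finally show "(boundary_matrix e p * boundary_matrix e (Suc p)) $$ (i, j)
      = 0\<^sub>m (dim_row (boundary_matrix e p)) (length (e (Suc p))) $$ (i, j)"
    using i j by simp
qed simp_all

section \<open>Inverses of orthogonal sums\<close>

text \<open>
  The transpose of \<open>L U\<close> is \<open>U L\<close>, while \<open>U U\<close> is symmetric, so \<open>L\<close> commutes with \<open>U\<close>; an inverse
  inherits this.
\<close>

lemma inverse_mat_commutes:
  fixes U L M :: "'a::comm_semiring_1 mat"
  assumes [simp]: "U \<in> carrier_mat n n" "L \<in> carrier_mat n n" "M \<in> carrier_mat n n"
    and left_inv: "M * L = 1\<^sub>m n" and right_inv: "L * M = 1\<^sub>m n"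
    and U: "transpose_mat U = U" and L: "transpose_mat L = L" and LU: "L * U = U * U"
  shows "M * U = U * M"
proof -
  note assoc = assoc_mult_mat[of _ n n _ n _ n]
  note [simp] = mult_carrier_mat[of _ n n _ n] left_mult_one_mat[of _ n n] right_mult_one_mat[of _ n n]
  have "U * L = transpose_mat (L * U)"
    by (simp add: transpose_mult[of _ n n _ n] U L)
  also have "\<dots> = L * U"
    by (simp add: LU transpose_mult[of _ n n _ n] U)
  finally have UL: "U * L = L * U" .
  have "M * U = M * (U * (L * M))" by (simp add: right_inv)
  also have "\<dots> = M * (U * L) * M" by (simp add: assoc)
  also have "\<dots> = (M * L) * (U * M)" unfolding UL by (simp add: assoc)
  finally show ?thesis by (simp add: left_inv)
qed

lemma symmetric_mat_inverse:
  fixes L M :: "'a::comm_semiring_1 mat"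
  assumes [simp]: "L \<in> carrier_mat n n" "M \<in> carrier_mat n n"
    and left_inv: "M * L = 1\<^sub>m n" and right_inv: "L * M = 1\<^sub>m n" and L: "transpose_mat L = L"
  shows "transpose_mat M = M"
proof -
  note assoc = assoc_mult_mat[of _ n n _ n _ n]
  note [simp] = mult_carrier_mat[of _ n n _ n] left_mult_one_mat[of _ n n] right_mult_one_mat[of _ n n]
  have "L * transpose_mat M = transpose_mat (M * L)"
    by (simp add: transpose_mult[of _ n n _ n] L)
  then have "L * transpose_mat M = 1\<^sub>m n" by (simp add: left_inv)
  then have "M * L * transpose_mat M = M"
    by (simp add: assoc)
  then show ?thesis by (simp add: left_inv)
qed

text \<open>
  The equation \<open>L U = U U\<close> says that \<open>L\<close> acts as \<open>U\<close> on the range of \<open>U\<close>. There \<open>M\<close> inverts \<open>U\<close>;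
  the outer factors in \<open>M U M\<close> cut \<open>M\<close> down to that range, on whose orthogonal complement the
  Moore--Penrose inverse has to vanish.
\<close>

lemma is_mp_inverse_sandwich:
  assumes [simp]: "U \<in> carrier_mat n n" "L \<in> carrier_mat n n" "M \<in> carrier_mat n n"
    and left_inv: "M * L = 1\<^sub>m n" and right_inv: "L * M = 1\<^sub>m n"
    and U: "transpose_mat U = U" and L: "transpose_mat L = L" and LU: "L * U = U * U"
  shows "is_mp_inverse U (M * U * M)"
proof -
  note assoc = assoc_mult_mat[of _ n n _ n _ n]
  note [simp] = mult_carrier_mat[of _ n n _ n] left_mult_one_mat[of _ n n] right_mult_one_mat[of _ n n]
  have comm: "M * U = U * M"
    by (rule inverse_mat_commutes[OF _ _ _ left_inv right_inv U L LU]) simp_all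
  have sym: "transpose_mat (U * M) = U * M"
    by (simp add: transpose_mult[of _ n n _ n] U symmetric_mat_inverse[OF _ _ left_inv right_inv L] comm)
  have UMU: "U * M * U = U"
  proof -
    have "U * M * U = M * (U * U)" by (simp add: assoc flip: comm)
    also have "\<dots> = M * L * U" by (simp add: assoc flip: LU)
    finally show ?thesis by (simp add: left_inv)
  qed
  have "U * (M * U * M) = U * M * U * M" by (simp add: assoc)
  then have UY: "U * (M * U * M) = U * M" by (simp only: UMU)
  have "M * U * M * U = M * (U * M * U)" by (simp add: assoc)
  then have YU: "M * U * M * U = U * M" by (simp only: UMU comm)
  have "U * M * (M * U * M) = M * (U * (M * U * M))"
    by (simp add: assoc flip: comm)
  also have "\<dots> = M * U * M" unfolding UY by (simp add: assoc)
  finally have YUY: "M * U * M * U * (M * U * M) = M * U * M" by (simp only: YU)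
  show ?thesis
    unfolding is_mp_inverse_def UY YU UMU sym carrier_matD[OF assms(1)]
    using YUY[unfolded YU] by simp
qed

text \<open>
  Inverting \<open>L\<close> agrees with inverting only the summand \<open>U\<close> as far as the columns of \<open>B\<close> are
  concerned: \<open>C\<close> vanishes on them, so \<open>L B = U B\<close> and hence \<open>M U B = M L B = B\<close>.
\<close>

lemma mult_inverse_orthogonal_sum:
  fixes B C W :: "real mat"
  assumes [simp]: "B \<in> carrier_mat n m" "C \<in> carrier_mat k n" "W \<in> carrier_mat m m"
    and W: "transpose_mat W = W" and CB: "C * B = 0\<^sub>m k m"
  defines "U \<equiv> B * W * transpose_mat B"
  defines "L \<equiv> U + transpose_mat C * C"
  assumes M [simp]: "M \<in> carrier_mat n n" and left_inv: "M * L = 1\<^sub>m n" and right_inv: "L * M = 1\<^sub>m n"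
  shows "transpose_mat B * mp_inverse U * B = transpose_mat B * M * B"
proof -
  have BW [simp]: "B * W \<in> carrier_mat n m" by (rule mult_carrier_mat[of _ _ m]) simp_all
  have U_carrier [simp]: "U \<in> carrier_mat n n"
    unfolding U_def by (rule mult_carrier_mat[of _ _ m]) simp_all
  have D_carrier [simp]: "transpose_mat C * C \<in> carrier_mat n n"
    by (rule mult_carrier_mat[of _ _ k]) simp_all
  have L_carrier [simp]: "L \<in> carrier_mat n n" by (simp add: L_def)
  have U_assoc: "U = B * (W * transpose_mat B)"
    unfolding U_def by (rule assoc_mult_mat[of _ n m _ m _ n]) simp_all
  have WBt [simp]: "W * transpose_mat B \<in> carrier_mat m n"
    by (rule mult_carrier_mat[of _ _ m]) simp_all
  have "transpose_mat U = B * transpose_mat (B * W)"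
    unfolding U_def by (subst transpose_mult[of _ n m _ n]) simp_all
  also have "\<dots> = U"
    unfolding U_assoc by (subst transpose_mult[of _ n m _ m]) (simp_all add: W)
  finally have U: "transpose_mat U = U" .
  have "transpose_mat (transpose_mat C * C) = transpose_mat C * C"
    by (simp add: transpose_mult[of _ n k _ n])
  then have L: "transpose_mat L = L"
    by (simp add: L_def transpose_add[of _ n n] U)
  have LB: "L * B = U * B"
  proof -
    have "transpose_mat C * C * B = transpose_mat C * (C * B)"
      by (rule assoc_mult_mat[of _ n k _ n _ m]) simp_all
    also have "\<dots> = 0\<^sub>m n m" by (simp add: CB right_mult_zero_mat[of _ n k])
    finally show ?thesis
      by (simp add: L_def add_mult_distrib_mat[of _ n n _ _ m] mult_carrier_mat[of _ n n])
  qed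
  have "L * U = L * B * (W * transpose_mat B)"
    by (subst U_assoc, rule assoc_mult_mat[of _ n n _ m _ n, symmetric]) simp_all
  also have "\<dots> = U * U"
    unfolding LB by (subst (3) U_assoc, rule assoc_mult_mat[of _ n n _ m _ n]) simp_all
  finally have LU: "L * U = U * U" .
  have mp: "mp_inverse U = M * U * M"
    by (intro mp_inverse_eqI is_mp_inverse_sandwich[OF _ _ _ left_inv right_inv U L LU]) simp_all
  have comm: "M * U = U * M"
    by (rule inverse_mat_commutes[OF _ _ _ left_inv right_inv U L LU]) simp_all
  have "M * U * B = M * L * B"
    by (simp add: assoc_mult_mat[of _ n n _ n _ m] LB)
  then have MUB: "M * U * B = B"
    by (simp add: left_inv left_mult_one_mat[of _ n m])
  have MU [simp]: "M * U \<in> carrier_mat n n" by (rule mult_carrier_mat[of _ _ n]) simp_all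
  have "transpose_mat B * (M * U * M) * B = transpose_mat B * (M * (U * M)) * B"
    by (simp add: assoc_mult_mat[of _ n n _ n _ n])
  also have "\<dots> = transpose_mat B * (M * (M * U)) * B" by (simp add: comm)
  also have "\<dots> = transpose_mat B * (M * (M * U * B))"
    by (simp add: assoc_mult_mat[of _ m n _ n _ m] assoc_mult_mat[of _ n n _ n _ m]
        mult_carrier_mat[of _ n n])
  also have "\<dots> = transpose_mat B * M * B"
    unfolding MUB by (rule assoc_mult_mat[of _ m n _ n _ m, symmetric]) simp_all
  finally show ?thesis by (simp add: mp)
qed

lemma the_mat_inverse:
  fixes A :: "'a::field mat"
  assumes A: "A \<in> carrier_mat n n" and inv: "invertible_mat A"
  shows "the (mat_inverse A) \<in> carrier_mat n n"
    and "the (mat_inverse A) * A = 1\<^sub>m n" and "A * the (mat_inverse A) = 1\<^sub>m n"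
proof -
  obtain B where AB: "A * B = 1\<^sub>m (dim_row A)" and BA: "B * A = 1\<^sub>m (dim_row B)"
    using inv by (auto simp: invertible_mat_def inverts_mat_def)
  have "dim_col (A * B) = n" "dim_col (B * A) = dim_row B"
    using A AB BA by simp_all
  then have B: "B \<in> carrier_mat n n" using A by auto
  have "mat_inverse A \<noteq> None"
  proof
    assume "mat_inverse A = None"
    then have "A \<notin> Units (ring_mat TYPE('a) n ())" by (rule mat_inverse(1)[OF A])
    moreover have "A \<in> Units (ring_mat TYPE('a) n ())"
      using A B AB BA by (auto simp: Units_def ring_mat_def)
    ultimately show False by simp
  qed
  then obtain M where "mat_inverse A = Some M" by auto
  with mat_inverse(2)[OF A this]
  show "the (mat_inverse A) \<in> carrier_mat n n"
    and "the (mat_inverse A) * A = 1\<^sub>m n" and "A * the (mat_inverse A) = 1\<^sub>m n"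
    by simp_all
qed

section \<open>Agreement of the resistance matrices\<close>

theorem proposition6p15:
  fixes X :: "'a::linorder set set"
    and e :: "nat \<Rightarrow> 'a set list"
    and w :: "'a set \<Rightarrow> real"
    and d :: nat
  assumes "simplicial_complex X"
    and "finite X"
    and "d \<ge> 1"
    and "has_dimension X d"
    and "simplex_enumeration X e"
    and "\<forall>\<sigma>\<in>simplices X d. w \<sigma> > 0"
    and "invertible_mat (hodge_laplacian e w d)"
  shows "resistance_matrix e w d = resistance_matrix' e w d"
proof -
  obtain p where d: "d = Suc p" using assms(3) by (cases d) auto
  define n where "n = length (e p)"
  define m where "m = length (e d)"
  define k where "k = dim_row (boundary_matrix e p)"
  have B: "boundary_matrix e d \<in> carrier_mat n m"
    by (simp add: d n_def m_def)
  have C: "boundary_matrix e p \<in> carrier_mat k n"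
    by (auto simp: k_def n_def)
  have W: "weight_matrix e w d \<in> carrier_mat m m"
    "transpose_mat (weight_matrix e w d) = weight_matrix e w d"
    by (auto simp: weight_matrix_def m_def mat_diag_def intro!: eq_matI)
  have CB: "boundary_matrix e p * boundary_matrix e d = 0\<^sub>m k m"
    unfolding d m_def k_def by (rule boundary_matrix_mult_boundary_matrix[OF assms(1,5)])
  have L: "hodge_laplacian e w d = boundary_matrix e d * weight_matrix e w d *
      transpose_mat (boundary_matrix e d) + transpose_mat (boundary_matrix e p) * boundary_matrix e p"
    by (simp add: hodge_laplacian_def up_laplacian_def d)
  have "hodge_laplacian e w d \<in> carrier_mat n n"
    unfolding L by (intro add_carrier_mat mult_carrier_mat[OF _ C]) (simp only: transpose_carrier_mat C)
  note M = the_mat_inverse[OF this assms(7)]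
  show ?thesis
    unfolding resistance_matrix_def resistance_matrix'_def up_laplacian_def
    by (rule mult_inverse_orthogonal_sum[OF B C W CB, folded L, OF M])
qed

end
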